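(* Let $(H,\langle -,-,-\rangle,\alpha)$ be a Hom-heap and let $o,u\in H$ satisfy $\alpha(o)=o$ and $\alpha(u)=u$. Let $G(H,\bullet_o,\alpha)$ and $G(H,\bullet_u,\alpha)$ be the Hom-groups obtained as retracts of $H$ at $o$ and at $u$. Define the translation maps \[ T_o^u: G(H,\bullet_o,\alpha)\to G(H,\bullet_u,\alpha),\quad T_o^u(x)=\langle x,o,u\rangle, \] \[ T_u^o: G(H,\bullet_u,\alpha)\to G(H,\bullet_o,\alpha),\quad T_u^o(y)=\langle \alpha^{-2}(y),u,o\rangle. \] Then $T_o^u$ and $T_u^o$ are homomorphisms of Hom-groups and are inverse to each other; in particular the Hom-groups $G(H,\bullet_o,\alpha)$ and $G(H,\bullet_u,\alpha)$ are isomorphic.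
   Context: A Hom-heap $(H,\langle -,-,-\rangle,\alpha)$ is a set $H$ with a bijective map $\alpha:H\to H$ and a ternary operation on $H$ such that for all $e,f,x,y,z\in H$: (i) $\langle x,x,y\rangle=\alpha(y)=\langle y,x,x\rangle$; (ii) $\langle \alpha(e),\alpha(f),\langle x,y,z\rangle\rangle=\langle\langle e,f,x\rangle,\alpha(y),\alpha(z)\rangle$; (iii) $\alpha\langle x,y,z\rangle=\langle\alpha(x),\alpha(y),\alpha(z)\rangle$. A Hom-group (regular) $(G,\bullet,\alpha)$ is a set $G$ with a distinguished element $e$ (the unit), a bijective map $\alpha:G\to G$ and a binary operation $\bullet$ such that for all $a,b,c\in G$: $\alpha(a)\bullet(b\bullet c)=(a\bullet b)\bullet\alpha(c)$; $\alpha(a\bullet b)=\alpha(a)\bullet\alpha(b)$; $a\bullet e=e\bullet a=\alpha(a)$; and for every $a$ there is $a^{-1}$ with $a\bullet a^{-1}=a^{-1}\bullet a=e$. For $x\in H$ with $\alpha(x)=x$, the retract $G(H,\bullet_x,\alpha)$ of $H$ at $x$ is the set $H$ with the operation $a\bullet_x b=\langle a,x,b\rangle$ and the map $\alpha$; it is a Hom-group with unit $x$. A homomorphism of Hom-groups $f:(G,\bullet,\alpha)\to(G',\star,\beta)$ is a map with $f(a\bullet b)=f(a)\star f(b)$ and $\beta(f(a))=f(\alpha(a))$ for all $a,b\in G$; it is an isomorphism if it is moreover bijective. *)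

theory Defs
  imports "HOL-Algebra.Group"
begin

record 'a hom_heap = "'a partial_object" +
  bracket :: "'a \<Rightarrow> 'a \<Rightarrow> 'a \<Rightarrow> 'a"
  heap_twist :: "'a \<Rightarrow> 'a"

locale hom_heap =
  fixes H :: "('a, 'b) hom_heap_scheme"
  assumes bracket_closed:
      "\<lbrakk>x \<in> carrier H; y \<in> carrier H; z \<in> carrier H\<rbrakk> \<Longrightarrow> bracket H x y z \<in> carrier H"
    and heap_twist_bij: "bij_betw (heap_twist H) (carrier H) (carrier H)"
    and bracket_left:
      "\<lbrakk>x \<in> carrier H; y \<in> carrier H\<rbrakk> \<Longrightarrow> bracket H x x y = heap_twist H y"
    and bracket_right:
      "\<lbrakk>x \<in> carrier H; y \<in> carrier H\<rbrakk> \<Longrightarrow> bracket H y x x = heap_twist H y"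
    and bracket_hom_assoc:
      "\<lbrakk>e \<in> carrier H; f \<in> carrier H; x \<in> carrier H; y \<in> carrier H; z \<in> carrier H\<rbrakk> \<Longrightarrow>
        bracket H (heap_twist H e) (heap_twist H f) (bracket H x y z) =
        bracket H (bracket H e f x) (heap_twist H y) (heap_twist H z)"
    and heap_twist_bracket:
      "\<lbrakk>x \<in> carrier H; y \<in> carrier H; z \<in> carrier H\<rbrakk> \<Longrightarrow>
        heap_twist H (bracket H x y z) =
        bracket H (heap_twist H x) (heap_twist H y) (heap_twist H z)"

text \<open>The record \<open>monoid\<close> only supplies the signature (carrier, product, unit) here;
  the product of a Hom-group need not be associative.\<close>

record 'a hom_group = "'a monoid" +
  twist :: "'a \<Rightarrow> 'a"

locale hom_group =
  fixes G :: "('a, 'b) hom_group_scheme" (structure)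
  assumes mult_closed: "\<lbrakk>a \<in> carrier G; b \<in> carrier G\<rbrakk> \<Longrightarrow> a \<otimes> b \<in> carrier G"
    and unit_closed: "\<one> \<in> carrier G"
    and twist_bij: "bij_betw (twist G) (carrier G) (carrier G)"
    and hom_assoc:
      "\<lbrakk>a \<in> carrier G; b \<in> carrier G; c \<in> carrier G\<rbrakk> \<Longrightarrow>
        twist G a \<otimes> (b \<otimes> c) = (a \<otimes> b) \<otimes> twist G c"
    and twist_mult:
      "\<lbrakk>a \<in> carrier G; b \<in> carrier G\<rbrakk> \<Longrightarrow> twist G (a \<otimes> b) = twist G a \<otimes> twist G b"
    and mult_unit: "a \<in> carrier G \<Longrightarrow> a \<otimes> \<one> = twist G a"
    and unit_mult: "a \<in> carrier G \<Longrightarrow> \<one> \<otimes> a = twist G a"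
    and inverse_ex: "a \<in> carrier G \<Longrightarrow> \<exists>b \<in> carrier G. a \<otimes> b = \<one> \<and> b \<otimes> a = \<one>"

locale hom_group_hom = source: hom_group G + target: hom_group G'
  for G :: "('a, 'b) hom_group_scheme" and G' :: "('c, 'd) hom_group_scheme" +
  fixes f :: "'a \<Rightarrow> 'c"
  assumes hom_closed: "f \<in> carrier G \<rightarrow> carrier G'"
    and hom_mult:
      "\<lbrakk>a \<in> carrier G; b \<in> carrier G\<rbrakk> \<Longrightarrow> f (a \<otimes>\<^bsub>G\<^esub> b) = f a \<otimes>\<^bsub>G'\<^esub> f b"
    and hom_twist: "a \<in> carrier G \<Longrightarrow> twist G' (f a) = f (twist G a)"

locale hom_group_iso = hom_group_hom +
  assumes hom_bij: "bij_betw f (carrier G) (carrier G')"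

definition hom_group_isomorphic ::
    "('a, 'b) hom_group_scheme \<Rightarrow> ('c, 'd) hom_group_scheme \<Rightarrow> bool" where
  "hom_group_isomorphic G G' \<longleftrightarrow> (\<exists>f. hom_group_iso G G' f)"

text \<open>The retract is a Hom-group only at points fixed by the twist.\<close>

definition retract_at :: "('a, 'b) hom_heap_scheme \<Rightarrow> 'a \<Rightarrow> 'a hom_group" where
  "retract_at H x =
    \<lparr>carrier = carrier H, mult = (\<lambda>a b. bracket H a x b), one = x, twist = heap_twist H\<rparr>"

text \<open>\<open>translation H p u\<close> is $T_p^u$ and \<open>back_translation H p u\<close> is $T_u^p$. The two are given by
  different formulas, so the second is not the first with \<open>p\<close> and \<open>u\<close> exchanged.\<close>

definition translation :: "('a, 'b) hom_heap_scheme \<Rightarrow> 'a \<Rightarrow> 'a \<Rightarrow> 'a \<Rightarrow> 'a" where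
  "translation H p u x = bracket H x p u"

definition back_translation :: "('a, 'b) hom_heap_scheme \<Rightarrow> 'a \<Rightarrow> 'a \<Rightarrow> 'a \<Rightarrow> 'a" where
  "back_translation H p u y =
    bracket H (((inv_into (carrier H) (heap_twist H)) ^^ 2) y) u p"

end

theory Submission
  imports Defs
begin

text \<open>As in an ordinary heap, adjacent equal entries cancel, here up to a twist: for fixed
  points \<open>p\<close> and \<open>u\<close> of the twist \<alpha>, bracketing [x, p, u] with u, z
  gives [\<alpha> x, p, z] (\<open>bracket_cancel_middle\<close>). With Hom-associativity this makes
  \<open>translation\<close> multiplicative: [[a, p, u], u, [b, p, u]] = [\<alpha> a, p, [b, p, u]]
  = [[a, p, b], p, u]. Taking z = p shows that translating from p to u and then by [-, u, p] sends x
  to [\<alpha> x, p, p], the double twist of x. The exponent -2 in \<open>back_translation\<close>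
  undoes exactly this, so the two maps are mutually inverse. The inverse of a homomorphism is again
  one (\<open>hom_group_hom_inverse\<close>), which settles \<open>back_translation\<close> without
  a second computation.\<close>

lemma hom_group_hom_inverse:
  assumes f: "hom_group_hom G G' f"
    and g: "g \<in> carrier G' \<rightarrow> carrier G"
    and gf: "\<And>x. x \<in> carrier G \<Longrightarrow> g (f x) = x"
    and fg: "\<And>y. y \<in> carrier G' \<Longrightarrow> f (g y) = y"
  shows "hom_group_hom G' G g"
proof -
  interpret hom_group_hom G G' f by (rule f)
  have gc: "g y \<in> carrier G" if "y \<in> carrier G'" for y
    using g that by blast
  show ?thesis
  proof unfold_locales
    show "g \<in> carrier G' \<rightarrow> carrier G" by (rule g)
  next
    fix a b assume ab: "a \<in> carrier G'" "b \<in> carrier G'"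
    \<comment> \<open>Both sides of the goal have the same image under \<open>f\<close>, and
      \<open>g\<close> cancels \<open>f\<close>; the twist is handled likewise below.\<close>
    have "f (g a \<otimes>\<^bsub>G\<^esub> g b) = a \<otimes>\<^bsub>G'\<^esub> b"
      using ab by (simp add: hom_mult gc fg)
    then show "g (a \<otimes>\<^bsub>G'\<^esub> b) = g a \<otimes>\<^bsub>G\<^esub> g b"
      using gf[OF source.mult_closed[OF gc gc], OF ab] by simp
  next
    fix a assume a: "a \<in> carrier G'"
    have tw: "twist G (g a) \<in> carrier G"
      using source.twist_bij gc[OF a] by (auto simp: bij_betw_def)
    have "f (twist G (g a)) = twist G' a"
      using a hom_twist[OF gc[OF a]] by (simp add: fg)
    then show "twist G (g a) = g (twist G' a)"
      using gf[OF tw] by simp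
  qed
qed

context hom_heap
begin

abbreviation untwist :: "'a \<Rightarrow> 'a"
  where "untwist \<equiv> inv_into (carrier H) (heap_twist H)"

lemma heap_twist_closed: "x \<in> carrier H \<Longrightarrow> heap_twist H x \<in> carrier H"
  using heap_twist_bij by (auto simp: bij_betw_def)

lemma untwist_closed: "x \<in> carrier H \<Longrightarrow> untwist x \<in> carrier H"
  using heap_twist_bij by (metis bij_betw_def inv_into_into)

lemma heap_twist_untwist: "x \<in> carrier H \<Longrightarrow> heap_twist H (untwist x) = x"
  using heap_twist_bij by (metis bij_betw_inv_into_right)

lemma untwist_heap_twist: "x \<in> carrier H \<Longrightarrow> untwist (heap_twist H x) = x"
  using heap_twist_bij by (metis bij_betw_inv_into_left)

lemma untwist_bracket:
  assumes "x \<in> carrier H" "y \<in> carrier H" "z \<in> carrier H"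
  shows "untwist (bracket H x y z) = bracket H (untwist x) (untwist y) (untwist z)"
  using untwist_heap_twist[OF bracket_closed[of "untwist x" "untwist y" "untwist z"]] assms
  by (simp add: heap_twist_bracket untwist_closed heap_twist_untwist)

text \<open>The single cancellation rule behind both multiplicativity and the inverse laws.\<close>

lemma bracket_cancel_middle:
  assumes xs: "x \<in> carrier H" "p \<in> carrier H" "u \<in> carrier H" "z \<in> carrier H"
    and p: "heap_twist H p = p" and u: "heap_twist H u = u"
  shows "bracket H (bracket H x p u) u z = bracket H (heap_twist H x) p z"
proof -
  \<comment> \<open>The entries \<open>u\<close> and \<open>z\<close> must be twists for
    Hom-associativity to apply: \<open>u\<close> is its own twist, and \<open>z\<close> is the twist
    of \<open>untwist z\<close>.\<close>
  have "bracket H (bracket H x p u) u z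
      = bracket H (heap_twist H x) p (bracket H u u (untwist z))"
    using bracket_hom_assoc[of x p u u "untwist z"] xs p u
    by (simp add: untwist_closed heap_twist_untwist)
  also have "\<dots> = bracket H (heap_twist H x) p z"
    using xs by (simp add: bracket_left untwist_closed heap_twist_untwist)
  finally show ?thesis .
qed

text \<open>Since \<open>x\<close> is its own twist, the laws come from the heap axioms with
  \<open>x\<close> in the middle slot. Only inverses need a construction.\<close>

lemma hom_group_retract_at:
  assumes x: "x \<in> carrier H" and fixed: "heap_twist H x = x"
  shows "hom_group (retract_at H x)"
proof (unfold_locales, simp_all add: retract_at_def)
  show "bij_betw (heap_twist H) (carrier H) (carrier H)"
    by (rule heap_twist_bij)
next
  fix a assume a: "a \<in> carrier H"
  \<comment> \<open>In the heap of a group, where [a, b, c] is a times the inverse of b times c, the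
    inverse of \<open>a\<close> relative to the unit \<open>x\<close> is [x, a, x]. Here
    \<open>a\<close> is untwisted first, because regrouping twists it once.\<close>
  let ?c = "untwist a"
  let ?b = "bracket H x ?c x"
  have c: "?c \<in> carrier H" "heap_twist H ?c = a"
    using a by (simp_all add: untwist_closed heap_twist_untwist)
  have "bracket H a x ?b = bracket H (bracket H ?c x x) a x"
    using bracket_hom_assoc[of ?c x x ?c x] c x fixed by simp
  also have "\<dots> = x"
    using a c x fixed by (simp add: bracket_left bracket_right)
  finally have right: "bracket H a x ?b = x" .
  have "bracket H ?b x a = bracket H x a (bracket H x x ?c)"
    using bracket_hom_assoc[of x ?c x x ?c] c x fixed by simp
  also have "\<dots> = x"
    using a c x fixed by (simp add: bracket_left bracket_right)
  finally have left: "bracket H ?b x a = x" .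
  show "\<exists>b\<in>carrier H. bracket H a x b = x \<and> bracket H b x a = x"
    using left right x c by (blast intro: bracket_closed)
next
  fix a b c assume "a \<in> carrier H" "b \<in> carrier H" "c \<in> carrier H"
  then show "bracket H (heap_twist H a) x (bracket H b x c)
      = bracket H (bracket H a x b) x (heap_twist H c)"
    using bracket_hom_assoc[of a x b x c] x fixed by simp
qed (use x fixed in \<open>simp_all add: bracket_closed bracket_left bracket_right heap_twist_bracket\<close>)

lemma hom_group_hom_translation:
  assumes p: "p \<in> carrier H" "heap_twist H p = p"
    and u: "u \<in> carrier H" "heap_twist H u = u"
  shows "hom_group_hom (retract_at H p) (retract_at H u) (translation H p u)"
proof (intro hom_group_hom.intro hom_group_hom_axioms.intro)
  show "hom_group (retract_at H p)" "hom_group (retract_at H u)"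
    using p u by (simp_all add: hom_group_retract_at)
next
  show "translation H p u \<in> carrier (retract_at H p) \<rightarrow> carrier (retract_at H u)"
    using p u by (auto simp: retract_at_def translation_def bracket_closed)
next
  fix a b assume "a \<in> carrier (retract_at H p)" "b \<in> carrier (retract_at H p)"
  then have ab: "a \<in> carrier H" "b \<in> carrier H" by (simp_all add: retract_at_def)
  have "bracket H (bracket H a p u) u (bracket H b p u)
      = bracket H (bracket H a p b) p u"
    using ab p u bracket_hom_assoc[of a p b p u]
    by (simp add: bracket_cancel_middle bracket_closed)
  then show "translation H p u (a \<otimes>\<^bsub>retract_at H p\<^esub> b)
      = translation H p u a \<otimes>\<^bsub>retract_at H u\<^esub> translation H p u b"
    by (simp add: retract_at_def translation_def)
next
  fix a assume "a \<in> carrier (retract_at H p)"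
  then show "twist (retract_at H u) (translation H p u a)
      = translation H p u (twist (retract_at H p) a)"
    using p u by (simp add: retract_at_def translation_def heap_twist_bracket)
qed

lemma back_translation_translation:
  assumes p: "p \<in> carrier H" "heap_twist H p = p"
    and u: "u \<in> carrier H" "heap_twist H u = u" and x: "x \<in> carrier H"
  shows "back_translation H p u (translation H p u x) = x"
proof -
  \<comment> \<open>With \<open>p\<close> and \<open>u\<close> fixed, untwisting [x, p, u] twice
    affects only \<open>x\<close>, so the cancellation rule applies.\<close>
  have fixed: "untwist p = p" "untwist u = u"
    using untwist_heap_twist[of p] untwist_heap_twist[of u] p u by simp_all
  show ?thesis
    using p u x fixed
    by (simp add: back_translation_def translation_def numeral_2_eq_2 untwist_bracket
        untwist_closed bracket_cancel_middle heap_twist_untwist bracket_right)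
qed

text \<open>The cancellation rule is used with \<open>p\<close> and \<open>u\<close> exchanged; the
  two untwists already sit on \<open>y\<close>, so nothing has to be moved through a
  bracket.\<close>

lemma translation_back_translation:
  assumes p: "p \<in> carrier H" "heap_twist H p = p"
    and u: "u \<in> carrier H" "heap_twist H u = u" and y: "y \<in> carrier H"
  shows "translation H p u (back_translation H p u y) = y"
  using p u y
  by (simp add: back_translation_def translation_def numeral_2_eq_2
      untwist_closed bracket_cancel_middle heap_twist_untwist bracket_right)

lemma back_translation_closed:
  "\<lbrakk>p \<in> carrier H; u \<in> carrier H; y \<in> carrier H\<rbrakk> \<Longrightarrow> back_translation H p u y \<in> carrier H"
  by (simp add: back_translation_def numeral_2_eq_2 untwist_closed bracket_closed)

end

theorem mainTheorem3:
  fixes H :: "('a, 'b) hom_heap_scheme" and p u :: 'a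
  assumes "hom_heap H"
    and "p \<in> carrier H" and "heap_twist H p = p"
    and "u \<in> carrier H" and "heap_twist H u = u"
  shows "hom_group_hom (retract_at H p) (retract_at H u) (translation H p u)
    \<and> hom_group_hom (retract_at H u) (retract_at H p) (back_translation H p u)
    \<and> (\<forall>x \<in> carrier H. back_translation H p u (translation H p u x) = x)
    \<and> (\<forall>y \<in> carrier H. translation H p u (back_translation H p u y) = y)
    \<and> hom_group_isomorphic (retract_at H p) (retract_at H u)"
proof -
  interpret hom_heap H by (rule assms(1))
  note T = hom_group_hom_translation[OF assms(2-5)]
  note ST = back_translation_translation[OF assms(2-5)]
  note TS = translation_back_translation[OF assms(2-5)]
  have carrier: "carrier (retract_at H x) = carrier H" for x
    by (simp add: retract_at_def)
  have S: "hom_group_hom (retract_at H u) (retract_at H p) (back_translation H p u)"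
    by (rule hom_group_hom_inverse[OF T])
      (simp_all add: carrier ST TS back_translation_closed assms(2,4))
  have "bij_betw (translation H p u) (carrier H) (carrier H)"
    by (rule bij_betw_byWitness[where f' = "back_translation H p u"])
      (use hom_group_hom.hom_closed[OF T] in
        \<open>auto simp: carrier ST TS back_translation_closed assms(2,4)\<close>)
  then have "hom_group_iso (retract_at H p) (retract_at H u) (translation H p u)"
    using T by (simp add: hom_group_iso_def hom_group_iso_axioms_def carrier)
  then show ?thesis
    using T S ST TS by (auto simp: hom_group_isomorphic_def)
qed

end
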